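(* For all integers $\Delta \geq 3$, $r \geq 1$ and $g \geq 1$ there exists a connected graph $H$ with maximum degree $\Delta$, power domination number $\gamma_p(H) = g$, propagation radius $rad_p(H) = r$ and order $n = g(r\Delta + 1)$.
   Context: All graphs are finite, simple, undirected and non-empty. For a graph $G$ and $S \subseteq V(G)$, define $P^1_G(S) = N[S]$ (the closed neighbourhood of $S$), and for $i \geq 1$ let $V^i = \{v \in P^i_G(S) : |N[v] \setminus P^i_G(S)| \leq 1\}$ and $P^{i+1}_G(S) = P^i_G(S) \cup N[V^i]$. The set $S$ is a power dominating set (PDS) of $G$ if $P^i_G(S) = V(G)$ for some $i \ge 1$. The power domination number $\gamma_p(G)$ is the minimum cardinality of a PDS of $G$. For a PDS $S$, $rad_p(G,S) = \min\{i \geq 1 : P^i_G(S) = V(G)\}$. The propagation radius of $G$ is $rad_p(G) = \min\{rad_p(G,S) : S \text{ is a PDS of } G \text{ with } |S| = \gamma_p(G)\}$. *)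

theory Defs
  imports "Graph_Theory.Graph_Theory"
begin

text \<open>
  Finite simple undirected graphs are the symmetric, loop-free digraphs without parallel arcs
  of the locale \<^locale>\<open>graph\<close>: an edge \<open>uv\<close> is a pair of opposite arcs. Hence the out-degree of a
  vertex is its degree. The locale admits the null graph; \<^const>\<open>connected\<close> excludes it.
\<close>

definition max_degree :: "('a, 'b) pre_digraph \<Rightarrow> nat" where
  "max_degree G = Max (out_degree G ` verts G)"

definition closed_nbhd :: "('a, 'b) pre_digraph \<Rightarrow> 'a \<Rightarrow> 'a set" where
  "closed_nbhd G v = insert v {u. v \<rightarrow>\<^bsub>G\<^esub> u}"

definition closed_nbhd_set :: "('a, 'b) pre_digraph \<Rightarrow> 'a set \<Rightarrow> 'a set" where
  "closed_nbhd_set G S = (\<Union>v\<in>S. closed_nbhd G v)"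

definition propagate :: "('a, 'b) pre_digraph \<Rightarrow> 'a set \<Rightarrow> 'a set" where
  "propagate G A = A \<union> closed_nbhd_set G {v \<in> A. card (closed_nbhd G v - A) \<le> 1}"

text \<open>
  \<open>observed G S i\<close> is the set $P^i_G(S)$. The sets are indexed from $i = 1$; the value at
  \<open>0\<close> is a dummy, and every use below requires \<open>1 \<le> i\<close>.
\<close>

fun observed :: "('a, 'b) pre_digraph \<Rightarrow> 'a set \<Rightarrow> nat \<Rightarrow> 'a set" where
  "observed G S 0 = {}"
| "observed G S (Suc 0) = closed_nbhd_set G S"
| "observed G S (Suc (Suc i)) = propagate G (observed G S (Suc i))"

definition power_dominating_set :: "('a, 'b) pre_digraph \<Rightarrow> 'a set \<Rightarrow> bool" where
  "power_dominating_set G S \<longleftrightarrow> S \<subseteq> verts G \<and> (\<exists>i\<ge>1. observed G S i = verts G)"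

definition power_domination_number :: "('a, 'b) pre_digraph \<Rightarrow> nat" where
  "power_domination_number G = (LEAST k. \<exists>S. power_dominating_set G S \<and> card S = k)"

definition set_radius :: "('a, 'b) pre_digraph \<Rightarrow> 'a set \<Rightarrow> nat" where
  "set_radius G S = (LEAST i. 1 \<le> i \<and> observed G S i = verts G)"

definition propagation_radius :: "('a, 'b) pre_digraph \<Rightarrow> nat" where
  "propagation_radius G =
    (LEAST k. \<exists>S. power_dominating_set G S \<and> card S = power_domination_number G \<and> set_radius G S = k)"

end

theory Submission
  imports Defs
begin

text \<open>
  Take \<open>g\<close> spiders, each with a centre and \<open>\<Delta>\<close> legs of length \<open>r\<close>, and join the ends of the
  zeroth legs in a path. The centres observe everything in \<open>r\<close> rounds, because the added edges
  join vertices that are observed simultaneously. Conversely, the union of the legs 1 and 2 of a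
  spider is a fort: its only outside neighbour, the centre, has two neighbours in it. Hence every
  power dominating set meets this union or contains the centre, so it has at least \<open>g\<close> elements;
  if it has exactly \<open>g\<close>, one of the legs 1 and 2 of the first spider contains none of them, and
  the observed part of that leg grows by at most one vertex per round.
\<close>

section \<open>Observed sets in general digraphs: forts and the speed of propagation\<close>

lemma observed_Suc: "1 \<le> i \<Longrightarrow> observed G S (Suc i) = propagate G (observed G S i)"
  by (cases i) auto

lemma (in wf_digraph) closed_nbhd_subset_verts: "v \<in> verts G \<Longrightarrow> closed_nbhd G v \<subseteq> verts G"
  by (auto simp: closed_nbhd_def dest: adj_in_verts)

text \<open>An infinite set has \<open>card\<close> 0 and would pass the test \<open>\<le> 1\<close>
  in \<open>propagate\<close>; finiteness makes that count genuine.\<close>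

lemma (in fin_digraph) finite_closed_nbhd: "finite (closed_nbhd G v)"
proof -
  have "closed_nbhd G v \<subseteq> insert v (verts G)"
    by (auto simp: closed_nbhd_def dest: adj_in_verts)
  then show ?thesis
    by (rule finite_subset) simp
qed

lemma (in wf_digraph) observed_subset_verts:
  assumes "S \<subseteq> verts G"
  shows "observed G S i \<subseteq> verts G"
proof (induction i)
  case (Suc i)
  have "closed_nbhd_set G A \<subseteq> verts G" if "A \<subseteq> verts G" for A
    using closed_nbhd_subset_verts that unfolding closed_nbhd_set_def by blast
  moreover have "{v \<in> observed G S i. P v} \<subseteq> verts G" for P
    using Suc by blast
  ultimately show ?case
    using Suc assms by (cases i) (simp_all add: propagate_def)
qed simp

text \<open>A vertex of \<open>F\<close> could only be observed through an observed, hence outside,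
  neighbour \<open>u\<close>. But \<open>u\<close> has a second neighbour in \<open>F\<close>, also
  unobserved, so \<open>u\<close> does not propagate.\<close>

lemma (in fin_digraph) observed_avoids_fort:
  assumes disj: "F \<inter> closed_nbhd_set G S = {}"
    and fort: "\<And>u v. u \<notin> F \<Longrightarrow> v \<in> F \<Longrightarrow> u \<rightarrow> v \<Longrightarrow> \<exists>w\<in>F. w \<noteq> v \<and> u \<rightarrow> w"
  shows "F \<inter> observed G S i = {}"
proof (induction i)
  case (Suc i)
  show ?case
  proof (cases "i = 0")
    case False
    let ?A = "observed G S i"
    have "v \<notin> propagate G ?A" if "v \<in> F" for v
    proof
      assume "v \<in> propagate G ?A"
      with that Suc obtain u where u: "u \<in> ?A" "card (closed_nbhd G u - ?A) \<le> 1"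
        "v \<in> closed_nbhd G u"
        by (auto simp: propagate_def closed_nbhd_set_def)
      with Suc that have "u \<notin> F" "u \<rightarrow> v"
        by (auto simp: closed_nbhd_def)
      with that fort obtain w where w: "w \<in> F" "w \<noteq> v" "u \<rightarrow> w"
        by blast
      with u Suc that have "{v, w} \<subseteq> closed_nbhd G u - ?A"
        by (auto simp: closed_nbhd_def)
      then have "card {v, w} \<le> card (closed_nbhd G u - ?A)"
        by (intro card_mono) (auto simp: finite_closed_nbhd)
      with u w show False
        by simp
    qed
    then show ?thesis
      using False by (auto simp: observed_Suc)
  qed (use disj in simp)
qed simp

text \<open>Each round adds only neighbours of observed vertices. Round 1 is already a
  neighbourhood, so its bound is 1; index 0 is the empty dummy. Any such \<open>d\<close> will do,
  not only the distance from \<open>S\<close>.\<close>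

lemma observed_depth_le:
  fixes d :: "'a \<Rightarrow> nat"
  assumes "\<And>u. u \<in> S \<Longrightarrow> d u = 0" and step: "\<And>u v. u \<rightarrow>\<^bsub>G\<^esub> v \<Longrightarrow> d v \<le> Suc (d u)"
  shows "v \<in> observed G S i \<Longrightarrow> d v \<le> i"
proof (induction i arbitrary: v)
  case (Suc i)
  show ?case
  proof (cases "i = 0")
    case True
    with Suc.prems assms(1) step show ?thesis
      by (fastforce simp: closed_nbhd_set_def closed_nbhd_def)
  next
    case False
    with Suc.prems obtain u where u: "u \<in> observed G S i" "v = u \<or> u \<rightarrow>\<^bsub>G\<^esub> v"
      by (auto simp: observed_Suc propagate_def closed_nbhd_set_def closed_nbhd_def)
    with step[of u v] Suc.IH[OF u(1)] show ?thesis
      by auto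
  qed
qed simp

section \<open>The chain of spiders as a graph, and its order\<close>

text \<open>
  The triple \<open>(i, a, j)\<close> with \<open>j \<ge> 1\<close> is the \<open>j\<close>-th vertex on leg \<open>a\<close> of spider \<open>i\<close>, and
  \<open>(i, 0, 0)\<close> is the centre of that spider.
\<close>

locale spider_chain =
  fixes \<Delta> r g :: nat
  assumes \<Delta>_ge: "\<Delta> \<ge> 3" and r_ge: "r \<ge> 1" and g_ge: "g \<ge> 1"
begin

definition labels :: "(nat \<times> nat \<times> nat) set" where
  "labels = {(i, a, j). i < g \<and> a < \<Delta> \<and> j \<le> r \<and> (j = 0 \<longrightarrow> a = 0)}"

text \<open>Each edge is listed in one direction only: away from the centre, or on to the next
  spider. \<open>H\<close> symmetrises.\<close>

fun link :: "nat \<times> nat \<times> nat \<Rightarrow> nat \<times> nat \<times> nat \<Rightarrow> bool" where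
  "link (i, a, j) (i', a', j') \<longleftrightarrow>
    i' = i \<and> j' = Suc j \<and> (j = 0 \<or> a' = a) \<or>
    i' = Suc i \<and> a = 0 \<and> a' = 0 \<and> j = r \<and> j' = r"

abbreviation enc :: "nat \<times> nat \<times> nat \<Rightarrow> nat" where
  "enc \<equiv> to_nat"

abbreviation dec :: "nat \<Rightarrow> nat \<times> nat \<times> nat" where
  "dec \<equiv> from_nat"

text \<open>Triples are encoded because the theorem asks for vertices of type \<open>nat\<close>.
  Taking arcs to be pairs excludes parallel arcs.\<close>

definition H :: "(nat, nat \<times> nat) pre_digraph" where
  "H = \<lparr>verts = enc ` labels,
    arcs = {(enc x, enc y) | x y. x \<in> labels \<and> y \<in> labels \<and> (link x y \<or> link y x)},
    tail = fst, head = snd\<rparr>"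

lemma verts_H [simp]: "verts H = enc ` labels"
  and tail_H [simp]: "tail H = fst"
  and head_H [simp]: "head H = snd"
  by (simp_all add: H_def)

lemma arcs_ends_H [simp]: "arcs_ends H = arcs H"
  by (simp add: arcs_ends_conv)

lemma arcs_H_iff [simp]:
  "(enc x, enc y) \<in> arcs H \<longleftrightarrow> x \<in> labels \<and> y \<in> labels \<and> (link x y \<or> link y x)"
  by (simp add: H_def del: split_paired_Ex link.simps)

lemma arcs_HE:
  assumes "(u, v) \<in> arcs H"
  obtains x y where "u = enc x" "v = enc y" "x \<in> labels" "y \<in> labels" "link x y \<or> link y x"
  using assms by (auto simp: H_def)

lemma labels_eq:
  "labels = (\<lambda>i. (i, 0, 0)) ` {..<g} \<union> {..<g} \<times> {..<\<Delta>} \<times> {1..r}"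
  using \<Delta>_ge by (auto simp: labels_def image_iff)

lemma finite_labels [simp]: "finite labels"
  by (simp add: labels_eq)

lemma card_labels: "card labels = g * (r * \<Delta> + 1)"
proof -
  have "card labels = card ((\<lambda>i. (i, 0::nat, 0::nat)) ` {..<g}) + card ({..<g} \<times> {..<\<Delta>} \<times> {1..r})"
    unfolding labels_eq by (rule card_Un_disjoint) auto
  also have "card ((\<lambda>i. (i, 0::nat, 0::nat)) ` {..<g}) = g"
    by (subst card_image) (auto simp: inj_on_def)
  finally show ?thesis
    by (simp add: card_cartesian_product algebra_simps)
qed

lemma card_verts_H: "card (verts H) = g * (r * \<Delta> + 1)"
  by (simp add: card_image card_labels)

lemma link_irrefl: "\<not> link x x"
  by (cases x) auto

lemma graph_H: "graph H"
proof
  have "arcs H \<subseteq> verts H \<times> verts H"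
    by (auto simp: H_def)
  then show "finite (arcs H)"
    by (rule finite_subset) simp
  show "symmetric H"
    by (auto simp: symmetric_def sym_def elim!: arcs_HE)
  show "\<And>e. e \<in> arcs H \<Longrightarrow> tail H e \<noteq> head H e"
    by (auto simp: link_irrefl elim!: arcs_HE)
qed (auto simp: arc_to_ends_def elim: arcs_HE)

sublocale graph H
  by (rule graph_H)

section \<open>Connectedness\<close>

lemma reachable_centre:
  assumes "(i, a, j) \<in> labels"
  shows "enc (i, a, j) \<rightarrow>\<^sup>*\<^bsub>H\<^esub> enc (i, 0, 0)"
  using assms
proof (induction j arbitrary: a)
  case 0
  then show ?case
    by (auto simp: labels_def)
next
  case (Suc j)
  \<comment> \<open>Below level 1 lies the centre, whose only label has leg index 0.\<close>
  let ?b = "if j = 0 then 0 else a"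
  have mem: "(i, ?b, j) \<in> labels"
    using Suc.prems by (auto simp: labels_def)
  with Suc.prems have "enc (i, a, Suc j) \<rightarrow>\<^bsub>H\<^esub> enc (i, ?b, j)"
    by simp
  then show ?case
    using Suc.IH[OF mem] by (rule adj_reachable_trans)
qed

lemma reachable_first_centre:
  assumes "i < g"
  shows "enc (i, 0, 0) \<rightarrow>\<^sup>*\<^bsub>H\<^esub> enc (0, 0, 0)"
  using assms
proof (induction i)
  case 0
  then show ?case
    using \<Delta>_ge by (intro reachable_centre) (auto simp: labels_def)
next
  case (Suc i)
  have mem: "(Suc i, 0, r) \<in> labels" "(i, 0, r) \<in> labels"
    using Suc.prems \<Delta>_ge by (auto simp: labels_def)
  have "enc (Suc i, 0, 0) \<rightarrow>\<^sup>*\<^bsub>H\<^esub> enc (Suc i, 0, r)"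
    using reachable_centre[OF mem(1)] by (rule symmetric_reachable')
  also have "enc (Suc i, 0, r) \<rightarrow>\<^bsub>H\<^esub> enc (i, 0, r)"
    using mem by simp
  also have "enc (i, 0, r) \<rightarrow>\<^sup>*\<^bsub>H\<^esub> enc (i, 0, 0)"
    using mem(2) by (rule reachable_centre)
  also have "enc (i, 0, 0) \<rightarrow>\<^sup>*\<^bsub>H\<^esub> enc (0, 0, 0)"
    using Suc by simp
  finally show ?case .
qed

lemma connected_H: "connected H"
proof (rule connectedI)
  show "verts H \<noteq> {}"
    using g_ge by (auto simp: labels_eq lessThan_empty_iff)
  have root: "u \<rightarrow>\<^sup>*\<^bsub>H\<^esub> enc (0, 0, 0)" if u: "u \<in> verts H" for u
  proof -
    obtain i a j where x: "u = enc (i, a, j)" "(i, a, j) \<in> labels"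
      using u by auto
    then have "u \<rightarrow>\<^sup>*\<^bsub>H\<^esub> enc (i, 0, 0)"
      by (simp add: reachable_centre)
    also have "enc (i, 0, 0) \<rightarrow>\<^sup>*\<^bsub>H\<^esub> enc (0, 0, 0)"
      using x by (intro reachable_first_centre) (simp add: labels_def)
    finally show ?thesis .
  qed
  show "u \<rightarrow>\<^sup>*\<^bsub>mk_symmetric H\<^esub> v" if "u \<in> verts H" "v \<in> verts H" for u v
    using that
    by (intro reachable_mk_symmetricI reachable_trans[OF root symmetric_reachable'[OF root]])
qed

section \<open>Maximum degree\<close>

lemma out_degree_H: "out_degree H (enc x) = card {y \<in> labels. x \<in> labels \<and> (link x y \<or> link y x)}"
proof -
  have "out_arcs H (enc x) =
      (\<lambda>y. (enc x, enc y)) ` {y \<in> labels. x \<in> labels \<and> (link x y \<or> link y x)}"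
    by (auto simp: out_arcs_def elim!: arcs_HE)
  then show ?thesis
    by (simp add: out_degree_def card_image inj_on_def)
qed

text \<open>As \<open>r \<ge> 1\<close>, the chain edges, which join vertices of level
  \<open>r\<close>, do not touch the centre.\<close>

lemma out_degree_centre:
  assumes "i < g"
  shows "out_degree H (enc (i, 0, 0)) = \<Delta>"
proof -
  have "{y \<in> labels. (i, 0, 0) \<in> labels \<and> (link (i, 0, 0) y \<or> link y (i, 0, 0))} =
      (\<lambda>a. (i, a, 1)) ` {..<\<Delta>}"
    using assms r_ge \<Delta>_ge by (auto simp: labels_def)
  then show ?thesis
    by (simp add: out_degree_H card_image inj_on_def)
qed

lemma out_degree_leg_le:
  assumes "j \<noteq> 0"
  shows "out_degree H (enc (i, a, j)) \<le> \<Delta>"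
proof -
  \<comment> \<open>A superset of the neighbours: inwards, outwards or to the next spider, and to
    the previous spider. Its three elements are matched by \<open>\<Delta> \<ge> 3\<close>.\<close>
  let ?N = "{(i, if j = 1 then 0 else a, j - 1), if j = r then (Suc i, 0, r) else (i, a, Suc j),
    (i - 1, 0, r)}"
  have "out_degree H (enc (i, a, j)) \<le> card ?N"
    unfolding out_degree_H
  proof (intro card_mono subsetI)
    fix y
    assume y: "y \<in> {y \<in> labels. (i, a, j) \<in> labels \<and> (link (i, a, j) y \<or> link y (i, a, j))}"
    obtain i' a' j' where y_eq: "y = (i', a', j')"
      by (cases y) auto
    from y consider "link (i, a, j) y" | "link y (i, a, j)"
      by blast
    then show "y \<in> ?N"
    proof cases
      case 1
      with y assms show ?thesis
        by (cases "j = r") (auto simp: y_eq labels_def)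
    next
      case 2
      with y assms show ?thesis
        by (cases "j' = 0") (auto simp: y_eq labels_def)
    qed
  qed simp
  also have "\<dots> \<le> 3"
    by (simp add: card_insert_if)
  finally show ?thesis
    using \<Delta>_ge by simp
qed

lemma max_degree_H: "max_degree H = \<Delta>"
  unfolding max_degree_def
proof (rule Max_eqI)
  show "\<Delta> \<in> out_degree H ` verts H"
  proof (rule image_eqI)
    show "\<Delta> = out_degree H (enc (0, 0, 0))"
      using out_degree_centre g_ge by simp
    show "enc (0, 0, 0) \<in> verts H"
      using g_ge by (auto simp: labels_eq)
  qed
  show "d \<le> \<Delta>" if d: "d \<in> out_degree H ` verts H" for d
  proof -
    obtain i a j where "d = out_degree H (enc (i, a, j))" "(i, a, j) \<in> labels"
      using d by auto
    then show ?thesis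
      using out_degree_centre[of i] out_degree_leg_le[of j i a]
      by (cases "j = 0") (auto simp: labels_def)
  qed
qed simp

section \<open>Upper bounds from the set of centres\<close>

definition centres :: "nat set" where
  "centres = (\<lambda>i. enc (i, 0, 0)) ` {..<g}"

lemma card_centres: "card centres = g"
  by (simp add: centres_def card_image inj_on_def)

lemma centres_subset: "centres \<subseteq> verts H"
  by (auto simp: centres_def labels_eq)

text \<open>For \<open>1 \<le> t < r\<close> a vertex at level \<open>t\<close> has just one
  neighbour above level \<open>t\<close>, the next one on its leg, which it therefore
  forces.\<close>

lemma levels_subset_observed_centres:
  assumes "1 \<le> t" and "(i, a, j) \<in> labels" and "j \<le> t"
  shows "enc (i, a, j) \<in> observed H centres t"
  using assms
proof (induction t arbitrary: i a j)
  case (Suc t)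
  show ?case
  proof (cases "t = 0")
    case True
    have "enc (i, a, j) \<in> closed_nbhd H (enc (i, 0, 0))"
    proof (cases "j = 0")
      case False
      then have "j = 1"
        using Suc.prems True by simp
      then show ?thesis
        using Suc.prems by (auto simp: closed_nbhd_def labels_def)
    qed (use Suc.prems in \<open>auto simp: closed_nbhd_def labels_def\<close>)
    then show ?thesis
      using True Suc.prems by (auto simp: closed_nbhd_set_def centres_def labels_def)
  next
    case False
    let ?A = "observed H centres t"
    show ?thesis
    proof (cases "j \<le> t")
      case True
      then show ?thesis
        using Suc False by (simp add: observed_Suc propagate_def)
    next
      assume "\<not> j \<le> t"
      with Suc.prems have j: "j = Suc t"
        by simp
      \<comment> \<open>The forcing vertex. Since \<open>t \<noteq> 0\<close>, it is a leg vertex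
        and not the centre.\<close>
      have mem: "(i, a, t) \<in> labels"
        using Suc.prems False j by (auto simp: labels_def)
      have "closed_nbhd H (enc (i, a, t)) - ?A \<subseteq> {enc (i, a, j)}"
      proof
        fix v assume v: "v \<in> closed_nbhd H (enc (i, a, t)) - ?A"
        then have "v \<noteq> enc (i, a, t)"
          using Suc.IH[OF _ mem] False by auto
        with v have "(enc (i, a, t), v) \<in> arcs H"
          by (simp add: closed_nbhd_def)
        then obtain i' a' j' where y: "v = enc (i', a', j')" "(i', a', j') \<in> labels"
          "link (i, a, t) (i', a', j') \<or> link (i', a', j') (i, a, t)"
          by (auto elim!: arcs_HE)
        have "\<not> j' \<le> t"
          using v y Suc.IH False by auto
        \<comment> \<open>This rules out chain edges at \<open>(i, a, t)\<close>.\<close>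
        moreover have "t < r"
          using Suc.prems j by (simp add: labels_def)
        ultimately show "v \<in> {enc (i, a, j)}"
          using y j False by auto
      qed
      then have "card (closed_nbhd H (enc (i, a, t)) - ?A) \<le> 1"
        using card_mono[of "{enc (i, a, j)}"] by simp
      moreover have "enc (i, a, t) \<in> ?A"
        using Suc.IH mem False by simp
      moreover have "enc (i, a, j) \<in> closed_nbhd H (enc (i, a, t))"
        using mem Suc.prems j by (simp add: closed_nbhd_def)
      ultimately show ?thesis
        using False by (auto simp: observed_Suc propagate_def closed_nbhd_set_def)
    qed
  qed
qed simp

lemma observed_centres: "observed H centres r = verts H"
proof
  show "verts H \<subseteq> observed H centres r"
    using levels_subset_observed_centres r_ge by (auto simp: labels_def)
qed (rule observed_subset_verts[OF centres_subset])

lemma pds_centres: "power_dominating_set H centres"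
  using centres_subset observed_centres r_ge by (auto simp: power_dominating_set_def)

section \<open>Lower bound for the power domination number\<close>

text \<open>The fort of spider \<open>i\<close>. Leg 0 is left out because its end carries the chain
  edges.\<close>

definition legs :: "nat \<Rightarrow> nat set" where
  "legs i = {enc (i, a, j) | a j. a \<in> {1, 2} \<and> 1 \<le> j \<and> j \<le> r}"

lemma closed_nbhd_meets_legs:
  assumes "v \<in> legs i" and "v \<in> closed_nbhd H u"
  shows "u \<in> insert (enc (i, 0, 0)) (legs i)"
proof (cases "v = u")
  case False
  then have "(u, v) \<in> arcs H"
    using assms(2) by (simp add: closed_nbhd_def)
  then show ?thesis
    using assms(1) by (auto simp: legs_def labels_def elim!: arcs_HE)
qed (use assms in simp)

lemma pds_meets_spider:
  assumes "power_dominating_set H S" and "i < g"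
  shows "S \<inter> insert (enc (i, 0, 0)) (legs i) \<noteq> {}"
proof
  assume empty: "S \<inter> insert (enc (i, 0, 0)) (legs i) = {}"
  obtain t where t: "observed H S t = verts H"
    using assms(1) by (auto simp: power_dominating_set_def)
  have "legs i \<inter> observed H S t = {}"
  proof (rule observed_avoids_fort)
    show "legs i \<inter> closed_nbhd_set H S = {}"
      using empty closed_nbhd_meets_legs by (fastforce simp: closed_nbhd_set_def)
    fix u v assume uv: "u \<notin> legs i" "v \<in> legs i" "u \<rightarrow>\<^bsub>H\<^esub> v"
    then have u: "u = enc (i, 0, 0)"
      using closed_nbhd_meets_legs[of v i u] by (auto simp: closed_nbhd_def)
    \<comment> \<open>The vertex \<open>v\<close> cannot be first on both legs; the first vertex of
      leg \<open>b\<close> is the second neighbour of the centre in the fort.\<close>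
    obtain b where b: "b \<in> {1, 2}" "v \<noteq> enc (i, b, 1)"
      by (cases "v = enc (i, 1, 1)") (auto intro: that[of 1] that[of 2])
    have "enc (i, b, 1) \<in> legs i"
      using b r_ge by (auto simp: legs_def)
    moreover have "u \<rightarrow>\<^bsub>H\<^esub> enc (i, b, 1)"
      using b r_ge \<Delta>_ge assms(2) by (auto simp: u labels_def)
    ultimately show "\<exists>w\<in>legs i. w \<noteq> v \<and> u \<rightarrow>\<^bsub>H\<^esub> w"
      using b by metis
  qed
  moreover have "enc (i, 1, 1) \<in> legs i \<inter> verts H"
    using assms(2) r_ge \<Delta>_ge by (auto simp: legs_def labels_def)
  ultimately show False
    using t by blast
qed

definition spider :: "nat \<Rightarrow> nat" where
  "spider u = fst (dec u)"

text \<open>Forts with their centres are disjoint for different spiders; expressed by a map, this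
  lets image cardinality bound \<open>card S\<close>.\<close>

lemma spider_legs: "u \<in> insert (enc (i, 0, 0)) (legs i) \<Longrightarrow> spider u = i"
  by (auto simp: spider_def legs_def)

lemma pds_finite: "power_dominating_set H S \<Longrightarrow> finite S"
  by (rule finite_subset[of S "verts H"]) (simp_all add: power_dominating_set_def)

lemma pds_card_ge:
  assumes "power_dominating_set H S"
  shows "g \<le> card S"
proof -
  have "i \<in> spider ` S" if "i < g" for i
  proof -
    obtain s where "s \<in> S" "s \<in> insert (enc (i, 0, 0)) (legs i)"
      using pds_meets_spider[OF assms \<open>i < g\<close>] by blast
    with spider_legs[of s i] show ?thesis
      by blast
  qed
  then have "{..<g} \<subseteq> spider ` S"
    by blast
  then have "card {..<g} \<le> card S"
    using pds_finite[OF assms] by (rule surj_card_le[rotated])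
  then show ?thesis
    by simp
qed

lemma power_domination_number_H: "power_domination_number H = g"
  unfolding power_domination_number_def
proof (rule Least_equality)
  show "\<exists>S. power_dominating_set H S \<and> card S = g"
    using pds_centres card_centres by blast
qed (use pds_card_ge in blast)

section \<open>Lower bound for the propagation radius\<close>

text \<open>If \<open>S\<close> met both legs, dropping its vertex on leg 1 would leave fewer than
  \<open>g\<close> vertices that still represent all \<open>g\<close> spiders.\<close>

lemma minimum_pds_misses_leg:
  assumes pds: "power_dominating_set H S" and card: "card S = g"
  shows "\<exists>a\<in>{1, 2}. \<forall>j. enc (0, a, j) \<in> S \<longrightarrow> j = 0"
proof (rule ccontr)
  assume "\<not> ?thesis"
  then obtain j k where jk: "enc (0, 1, j) \<in> S" "enc (0, 2, k) \<in> S"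
    by blast
  let ?S' = "S - {enc (0, 1, j)}"
  have "i \<in> spider ` ?S'" if "i < g" for i
  proof (cases "i = 0")
    case True
    then show ?thesis
      using jk by (intro image_eqI[of _ _ "enc (0, 2, k)"]) (auto simp: spider_def)
  next
    case False
    obtain s where "s \<in> S" "s \<in> insert (enc (i, 0, 0)) (legs i)"
      using pds_meets_spider[OF pds \<open>i < g\<close>] by blast
    then have "s \<in> S" "spider s = i"
      by (simp_all only: spider_legs)
    with False show ?thesis
      by (intro image_eqI[of _ _ s]) (auto simp: spider_def)
  qed
  then have "{..<g} \<subseteq> spider ` ?S'"
    by blast
  then have "card {..<g} \<le> card ?S'"
    using pds_finite[OF pds] by (intro surj_card_le) simp_all
  moreover have "card ?S' < card S"
    using jk pds_finite[OF pds] by (intro card_Diff1_less)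
  ultimately show False
    using card by simp
qed

lemma minimum_pds_radius_ge:
  assumes pds: "power_dominating_set H S" and card: "card S = g" and obs: "observed H S t = verts H"
  shows "r \<le> t"
proof -
  obtain a where a: "a \<in> {1, 2}" and miss: "\<And>j. enc (0, a, j) \<in> S \<Longrightarrow> j = 0"
    using minimum_pds_misses_leg[OF pds card] by blast
  \<comment> \<open>Depth along the missed leg, 0 elsewhere. It vanishes on \<open>S\<close> by the
    choice of \<open>a\<close>, and it changes by at most one along arcs since leg 1 or 2 is
    attached to the rest only at the centre.\<close>
  define d :: "nat \<Rightarrow> nat" where
    "d u = (case dec u of (i, b, j) \<Rightarrow> if i = 0 \<and> b = a then j else 0)" for u
  have "d (enc (0, a, r)) \<le> t"
  proof (rule observed_depth_le[where d = d and S = S and G = H])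
    show "d u = 0" if u: "u \<in> S" for u
    proof -
      obtain i b j where "u = enc (i, b, j)"
        using pds u by (auto simp: power_dominating_set_def)
      with miss u show ?thesis
        by (auto simp: d_def)
    qed
    show "d v \<le> Suc (d u)" if "u \<rightarrow>\<^bsub>H\<^esub> v" for u v
      using that a by (auto simp: d_def labels_def elim!: arcs_HE)
    have "(0, a, r) \<in> labels"
      using a g_ge r_ge \<Delta>_ge by (auto simp: labels_def)
    then show "enc (0, a, r) \<in> observed H S t"
      by (simp add: obs)
  qed
  then show ?thesis
    by (simp add: d_def)
qed

lemma set_radius_centres: "set_radius H centres = r"
  unfolding set_radius_def
  using observed_centres r_ge minimum_pds_radius_ge[OF pds_centres card_centres]
  by (intro Least_equality) blast+

lemma minimum_pds_set_radius_ge: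
  assumes "power_dominating_set H S" and "card S = g"
  shows "r \<le> set_radius H S"
proof -
  have "\<exists>t. 1 \<le> t \<and> observed H S t = verts H"
    using assms(1) by (auto simp: power_dominating_set_def)
  then have "observed H S (set_radius H S) = verts H"
    unfolding set_radius_def by (rule LeastI2_ex) simp
  with assms show ?thesis
    by (rule minimum_pds_radius_ge)
qed

lemma propagation_radius_H: "propagation_radius H = r"
  unfolding propagation_radius_def power_domination_number_H
proof (rule Least_equality)
  show "\<exists>S. power_dominating_set H S \<and> card S = g \<and> set_radius H S = r"
    using pds_centres card_centres set_radius_centres by blast
qed (use minimum_pds_set_radius_ge in blast)

end

theorem mainTheorem7:
  fixes \<Delta> r g :: nat
  assumes "\<Delta> \<ge> 3" and "r \<ge> 1" and "g \<ge> 1"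
  shows "\<exists>H :: (nat, nat \<times> nat) pre_digraph.
    graph H \<and> connected H \<and>
    max_degree H = \<Delta> \<and>
    power_domination_number H = g \<and>
    propagation_radius H = r \<and>
    card (verts H) = g * (r * \<Delta> + 1)"
proof -
  interpret spider_chain \<Delta> r g
    by unfold_locales (use assms in auto)
  show ?thesis
    by (intro exI[of _ H] conjI graph_H connected_H max_degree_H power_domination_number_H
        propagation_radius_H card_verts_H)
qed

end
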